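(* Let $p$ be a prime, and let $G$ be a finitely generated residually finite-$p$ Turner group. If $g\in G$ is a test element of the pro-$p$ completion $\widehat{G}_p$, then $g$ is a test element of $G$.
   Context: Here $G$ is a discrete group and $\widehat{G}_p$ is its pro-$p$ completion; since $G$ is residually finite-$p$, the canonical map $G\to\widehat{G}_p$ is injective and $G$ is identified with its image. An element $g$ of a group $G$ is a test element of $G$ if every endomorphism $\varphi:G\to G$ with $\varphi(g)=g$ is an automorphism; for profinite groups, endomorphisms are required to be continuous. A retract of a group $G$ is a subgroup $H\le G$ for which there is an epimorphism $G\to H$ restricting to the identity on $H$. A (discrete) group $G$ is a Turner group if: an element $g\in G$ is a test element of $G$ if and only if it is not contained in any proper retract of $G$. *)

theory Defs
  imports "HOL-Algebra.Product_Groups" "HOL-Analysis.Function_Topology"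
    "HOL-Computational_Algebra.Primes"
begin

definition finitely_generated_group :: "('a, 'b) monoid_scheme \<Rightarrow> bool" where
  "finitely_generated_group G \<longleftrightarrow>
     (\<exists>S. finite S \<and> S \<subseteq> carrier G \<and> generate G S = carrier G)"

text \<open>For prime \<open>p\<close>, \<open>order (G Mod N) = p ^ k\<close> forces \<open>G Mod N\<close> to be finite, since \<open>order\<close>
  is \<open>0\<close> on infinite groups.\<close>

definition p_power_index_normal :: "nat \<Rightarrow> ('a, 'b) monoid_scheme \<Rightarrow> 'a set set" where
  "p_power_index_normal p G = {N. N \<lhd> G \<and> (\<exists>k. order (G Mod N) = p ^ k)}"

definition residually_finite_p :: "nat \<Rightarrow> ('a, 'b) monoid_scheme \<Rightarrow> bool" where
  "residually_finite_p p G \<longleftrightarrow>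
     (\<forall>g\<in>carrier G. g \<noteq> \<one>\<^bsub>G\<^esub> \<longrightarrow> (\<exists>N\<in>p_power_index_normal p G. g \<notin> N))"

definition test_element :: "('a, 'b) monoid_scheme \<Rightarrow> 'a \<Rightarrow> bool" where
  "test_element G g \<longleftrightarrow>
     g \<in> carrier G \<and> (\<forall>\<phi>\<in>hom G G. \<phi> g = g \<longrightarrow> \<phi> \<in> iso G G)"

text \<open>The version for a topological group, whose underlying group and topology are given by \<open>G\<close>
  and \<open>T\<close>; endomorphisms and automorphisms are those of topological groups.\<close>

definition topological_test_element ::
    "('a, 'b) monoid_scheme \<Rightarrow> 'a topology \<Rightarrow> 'a \<Rightarrow> bool" where
  "topological_test_element G T g \<longleftrightarrow>
     g \<in> carrier G \<and>
     (\<forall>\<phi>\<in>hom G G. continuous_map T T \<phi> \<and> \<phi> g = g \<longrightarrow>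
        \<phi> \<in> iso G G \<and> homeomorphic_map T T \<phi>)"

definition retract_of_group :: "'a set \<Rightarrow> ('a, 'b) monoid_scheme \<Rightarrow> bool" where
  "retract_of_group H G \<longleftrightarrow>
     subgroup H G \<and> (\<exists>r\<in>epi G (G\<lparr>carrier := H\<rparr>). \<forall>h\<in>H. r h = h)"

definition turner_group :: "('a, 'b) monoid_scheme \<Rightarrow> bool" where
  "turner_group G \<longleftrightarrow>
     (\<forall>g\<in>carrier G. test_element G g \<longleftrightarrow>
        \<not> (\<exists>H. retract_of_group H G \<and> H \<noteq> carrier G \<and> g \<in> H))"

text \<open>The inverse limit of the finite \<open>p\<close>-quotients \<open>G Mod N\<close>, realised inside their product.
  For \<open>M \<subseteq> N\<close> the projection \<open>G Mod M \<rightarrow> G Mod N\<close> sends the coset \<open>M g\<close> to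
  \<open>N (M g) = N g\<close>, i.e. it is the map \<open>C \<mapsto> N <#> C\<close>.\<close>

definition pro_p_completion ::
    "nat \<Rightarrow> ('a, 'b) monoid_scheme \<Rightarrow> ('a set \<Rightarrow> 'a set) monoid" where
  "pro_p_completion p G =
     (product_group (p_power_index_normal p G) (\<lambda>N. G Mod N))
       \<lparr>carrier := {x \<in> \<Pi>\<^sub>E N\<in>p_power_index_normal p G. carrier (G Mod N).
          \<forall>M\<in>p_power_index_normal p G. \<forall>N\<in>p_power_index_normal p G.
            M \<subseteq> N \<longrightarrow> N <#>\<^bsub>G\<^esub> x M = x N}\<rparr>"

definition pro_p_topology ::
    "nat \<Rightarrow> ('a, 'b) monoid_scheme \<Rightarrow> ('a set \<Rightarrow> 'a set) topology" where
  "pro_p_topology p G =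
     subtopology
       (product_topology (\<lambda>N. discrete_topology (carrier (G Mod N))) (p_power_index_normal p G))
       (carrier (pro_p_completion p G))"

definition pro_p_embedding :: "nat \<Rightarrow> ('a, 'b) monoid_scheme \<Rightarrow> 'a \<Rightarrow> 'a set \<Rightarrow> 'a set" where
  "pro_p_embedding p G g = (\<lambda>N\<in>p_power_index_normal p G. N #>\<^bsub>G\<^esub> g)"

end

theory Submission imports Defs begin

text \<open>A retraction \<open>r\<close> of \<open>G\<close> onto a proper retract containing \<open>g\<close> would be an idempotent
  endomorphism fixing \<open>g\<close>. It extends to a continuous endomorphism of the pro-\<open>p\<close> completion
  fixing the image of \<open>g\<close>, so the extension is injective. Since \<open>r (r x) = r x\<close>,
  injectivity of the extension and of \<open>G \<rightarrow> pro_p_completion p G\<close> gives \<open>r x = x\<close>, so the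
  retract is not proper.\<close>

text \<open>The coset \<open>C\<close> of the preimage of \<open>N\<close> is sent to the coset of \<open>N\<close> containing \<open>\<phi> ` C\<close>.\<close>

definition pro_p_map ::
    "nat \<Rightarrow> ('a, 'b) monoid_scheme \<Rightarrow> ('a \<Rightarrow> 'a) \<Rightarrow> ('a set \<Rightarrow> 'a set) \<Rightarrow> 'a set \<Rightarrow> 'a set" where
  "pro_p_map p G \<phi> x =
     (\<lambda>N\<in>p_power_index_normal p G. N <#>\<^bsub>G\<^esub> \<phi> ` x (\<phi> -` N \<inter> carrier G))"

section \<open>Coordinates, multiplication and topology of the completion\<close>

lemma carrier_pro_p_completionD:
  assumes "x \<in> carrier (pro_p_completion p G)"
  shows "N \<in> p_power_index_normal p G \<Longrightarrow> x N \<in> carrier (G Mod N)"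
    and "M \<in> p_power_index_normal p G \<Longrightarrow> N \<in> p_power_index_normal p G \<Longrightarrow> M \<subseteq> N \<Longrightarrow>
      N <#>\<^bsub>G\<^esub> x M = x N"
  using assms by (auto simp: pro_p_completion_def PiE_iff)

lemma mult_pro_p_completion:
  "x \<otimes>\<^bsub>pro_p_completion p G\<^esub> y = (\<lambda>N\<in>p_power_index_normal p G. x N <#>\<^bsub>G\<^esub> y N)"
  by (simp add: pro_p_completion_def product_group_def FactGroup_def)

lemma continuous_map_pro_p_projection:
  assumes "N \<in> p_power_index_normal p G"
  shows "continuous_map (pro_p_topology p G) (discrete_topology (carrier (G Mod N))) (\<lambda>x. x N)"
  unfolding pro_p_topology_def
  by (intro continuous_map_from_subtopology continuous_map_product_projection assms)

lemma topspace_pro_p_topology: "topspace (pro_p_topology p G) = carrier (pro_p_completion p G)"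
  by (auto simp: pro_p_topology_def pro_p_completion_def)

section \<open>Cosets and subgroups of \<open>p\<close>-power index under homomorphisms\<close>

context group
begin

text \<open>Since \<phi> maps \<open>M\<close> into \<open>N\<close>, every
  \<phi>\<open>(m a)\<close> differs from \<phi>\<open>(a)\<close> by a left factor in
  \<open>N\<close>, which \<open>N\<close> absorbs. Conversely \<phi>\<open>(a)\<close> itself lies
  in the image, so the whole coset is reached.\<close>

lemma set_mult_hom_image_rcos:
  assumes \<phi>: "\<phi> \<in> hom G G" and N: "subgroup N G" and M: "subgroup M G"
    and sub: "\<phi> ` M \<subseteq> N" and a: "a \<in> carrier G"
  shows "N <#> \<phi> ` (M #> a) = N #> \<phi> a"
proof
  have Nc: "N \<subseteq> carrier G" and Mc: "M \<subseteq> carrier G"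
    using N M by (auto dest: subgroup.subset)
  have \<phi>a: "\<phi> a \<in> carrier G" using \<phi> a by (rule hom_in_carrier)
  show "N <#> \<phi> ` (M #> a) \<subseteq> N #> \<phi> a"
  proof
    fix z assume "z \<in> N <#> \<phi> ` (M #> a)"
    then obtain n m where n: "n \<in> N" and m: "m \<in> M" and z: "z = n \<otimes> \<phi> (m \<otimes> a)"
      by (auto simp: set_mult_def r_coset_def)
    have "\<phi> m \<in> N" using sub m by blast
    moreover have "z = (n \<otimes> \<phi> m) \<otimes> \<phi> a"
      using z hom_mult[OF \<phi>, of m a] a m n Mc Nc \<phi>a calculation by (auto simp: m_assoc subset_iff)
    ultimately show "z \<in> N #> \<phi> a"
      using n subgroup.m_closed[OF N] by (auto simp: r_coset_def)
  qed
  have "\<phi> a \<in> \<phi> ` (M #> a)" using rcos_self[OF a M] by (rule imageI)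
  then show "N #> \<phi> a \<subseteq> N <#> \<phi> ` (M #> a)"
    unfolding set_mult_def r_coset_def[of G N] by blast
qed

text \<open>The preceding lemma for the identity homomorphism. For normal \<open>M\<close> and
  \<open>N\<close> it computes the transition map of the inverse system on coset
  representatives.\<close>

lemma set_mult_rcos_subset:
  assumes "subgroup N G" "subgroup M G" "M \<subseteq> N" "a \<in> carrier G"
  shows "N <#> (M #> a) = N #> a"
  using set_mult_hom_image_rcos[of "\<lambda>x. x" N M a] assms by (auto simp: hom_def)

text \<open>The preimage is the kernel of the composite \<psi> of \<phi> with the quotient map to
  \<open>G Mod N\<close>. By the first isomorphism theorem its quotient is a copy of a subgroup of
  \<open>G Mod N\<close>, so Lagrange's theorem bounds its order by divisibility.\<close>

lemma p_power_index_normal_vimage: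
  assumes p: "prime p" and \<phi>: "\<phi> \<in> hom G G" and N: "N \<in> p_power_index_normal p G"
  shows "\<phi> -` N \<inter> carrier G \<in> p_power_index_normal p G"
proof -
  from N obtain k where nN: "N \<lhd> G" and k: "order (G Mod N) = p ^ k"
    by (auto simp: p_power_index_normal_def)
  interpret Q: group "G Mod N" using nN by (rule normal.factorgroup_is_group)
  have sN: "subgroup N G" using nN by (rule normal_imp_subgroup)
  define \<psi> where "\<psi> = (\<lambda>x. N #> \<phi> x)"
  have \<psi>: "\<psi> \<in> hom G (G Mod N)"
    using Group.hom_compose[OF \<phi> normal.r_coset_hom_Mod[OF nN]] by (simp add: \<psi>_def comp_def)
  interpret h: group_hom G "G Mod N" \<psi>
    using \<psi> by unfold_locales
  have ker: "kernel G (G Mod N) \<psi> = \<phi> -` N \<inter> carrier G"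
    using hom_in_carrier[OF \<phi>] coset_join1[OF _ _ sN] coset_join2[OF _ sN] subgroup.subset[OF sN]
    by (auto simp: kernel_def \<psi>_def FactGroup_def)
  \<comment> \<open>The codomain is cut down to the image so that \<psi> becomes surjective, as the
    first isomorphism theorem requires.\<close>
  let ?I = "(G Mod N)\<lparr>carrier := \<psi> ` carrier G\<rparr>"
  interpret i: group_hom G ?I \<psi>
  proof (intro group_hom.intro group_hom_axioms.intro)
    show "group ?I" by (rule Q.subgroup_imp_group[OF h.img_is_subgroup])
    show "\<psi> \<in> hom G ?I" using \<psi> by (auto simp: hom_def)
  qed (rule group_axioms)
  have "(\<lambda>X. the_elem (\<psi> ` X)) \<in> iso (G Mod kernel G (G Mod N) \<psi>) ?I"
    using i.FactGroup_iso_set by (simp add: kernel_def)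
  then have "order (G Mod kernel G (G Mod N) \<psi>) = card (\<psi> ` carrier G)"
    by (auto simp: order_def iso_def intro: bij_betw_same_card)
  moreover have "card (\<psi> ` carrier G) dvd order (G Mod N)"
    using Q.lagrange[OF h.img_is_subgroup] by (metis dvd_triv_right)
  \<comment> \<open>Every divisor of a power of the prime \<open>p\<close> is itself a power of
    \<open>p\<close>.\<close>
  ultimately have "\<exists>i. order (G Mod (\<phi> -` N \<inter> carrier G)) = p ^ i"
    using k p divides_primepow_nat ker by metis
  moreover have "\<phi> -` N \<inter> carrier G \<lhd> G"
    using h.normal_kernel ker by simp
  ultimately show ?thesis by (simp add: p_power_index_normal_def)
qed

lemma subgroup_p_power_index_normal: "N \<in> p_power_index_normal p G \<Longrightarrow> subgroup N G"
  by (auto simp: p_power_index_normal_def normal_imp_subgroup)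

section \<open>Continuous extension of an endomorphism to the completion\<close>

lemma pro_p_completion_rcosE:
  assumes "x \<in> carrier (pro_p_completion p G)" "N \<in> p_power_index_normal p G"
  obtains a where "a \<in> carrier G" "x N = N #> a"
  using carrier_pro_p_completionD(1)[OF assms] by (auto simp: FactGroup_def RCOSETS_def)

text \<open>Reduces computations with the induced map to coset representatives. Only one coordinate
  of \<open>x\<close> is constrained, so \<open>x\<close> may be an arbitrary function and need not
  be a point of the completion.\<close>

lemma pro_p_map_rcos:
  assumes p: "prime p" and \<phi>: "\<phi> \<in> hom G G" and N: "N \<in> p_power_index_normal p G"
    and "a \<in> carrier G" "x (\<phi> -` N \<inter> carrier G) = (\<phi> -` N \<inter> carrier G) #> a"
  shows "pro_p_map p G \<phi> x N = N #> \<phi> a"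
  using set_mult_hom_image_rcos[OF \<phi>, of N "\<phi> -` N \<inter> carrier G" a] assms
    subgroup_p_power_index_normal p_power_index_normal_vimage[OF p \<phi> N]
  by (auto simp: pro_p_map_def)

lemma rcos_in_carrier_Mod: "a \<in> carrier G \<Longrightarrow> N #> a \<in> carrier (G Mod N)"
  by (auto simp: FactGroup_def RCOSETS_def)

lemma pro_p_embedding_carrier:
  assumes "x \<in> carrier G"
  shows "pro_p_embedding p G x \<in> carrier (pro_p_completion p G)"
  using assms
  by (auto simp: pro_p_completion_def pro_p_embedding_def rcos_in_carrier_Mod
      set_mult_rcos_subset subgroup_p_power_index_normal)

text \<open>This is the sense in which \<open>pro_p_map\<close> extends \<phi>: all coordinates of
  an embedded element share one representative, namely the element itself.\<close>

lemma pro_p_map_embedding: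
  assumes p: "prime p" and \<phi>: "\<phi> \<in> hom G G" and x: "x \<in> carrier G"
  shows "pro_p_map p G \<phi> (pro_p_embedding p G x) = pro_p_embedding p G (\<phi> x)"
proof (rule extensionalityI)
  fix N assume N: "N \<in> p_power_index_normal p G"
  show "pro_p_map p G \<phi> (pro_p_embedding p G x) N = pro_p_embedding p G (\<phi> x) N"
    using pro_p_map_rcos[OF p \<phi> N x] N p_power_index_normal_vimage[OF p \<phi> N]
    by (simp add: pro_p_embedding_def)
qed (auto simp: pro_p_map_def pro_p_embedding_def)

text \<open>Compatibility survives because an inclusion of \<open>M\<close> in \<open>N\<close>
  passes to their preimages: a representative of \<open>x\<close> at the preimage of
  \<open>M\<close> also represents \<open>x\<close> at the preimage of \<open>N\<close>, and so its
  image under \<phi> serves both coordinates.\<close>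

lemma pro_p_map_carrier:
  assumes p: "prime p" and \<phi>: "\<phi> \<in> hom G G" and x: "x \<in> carrier (pro_p_completion p G)"
  shows "pro_p_map p G \<phi> x \<in> carrier (pro_p_completion p G)"
proof -
  let ?P = "p_power_index_normal p G"
  let ?pre = "\<lambda>N. \<phi> -` N \<inter> carrier G"
  have pre: "?pre N \<in> ?P" if "N \<in> ?P" for N
    using p_power_index_normal_vimage[OF p \<phi> that] .
  have coset: "pro_p_map p G \<phi> x N \<in> carrier (G Mod N)" if N: "N \<in> ?P" for N
  proof -
    obtain a where a: "a \<in> carrier G" "x (?pre N) = ?pre N #> a"
      using pro_p_completion_rcosE[OF x pre[OF N]] .
    show ?thesis
      unfolding pro_p_map_rcos[where x = x, OF p \<phi> N a]
      by (rule rcos_in_carrier_Mod[OF hom_in_carrier[OF \<phi> a(1)]])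
  qed
  have compatible: "N <#> pro_p_map p G \<phi> x M = pro_p_map p G \<phi> x N"
    if M: "M \<in> ?P" and N: "N \<in> ?P" and sub: "M \<subseteq> N" for M N
  proof -
    obtain a where a: "a \<in> carrier G" "x (?pre M) = ?pre M #> a"
      using pro_p_completion_rcosE[OF x pre[OF M]] .
    have sub': "?pre M \<subseteq> ?pre N" using sub by blast
    have "x (?pre N) = ?pre N <#> (?pre M #> a)"
      using carrier_pro_p_completionD(2)[OF x pre[OF M] pre[OF N] sub'] a by simp
    also have "\<dots> = ?pre N #> a"
      by (intro set_mult_rcos_subset subgroup_p_power_index_normal[where p = p] pre M N sub' a(1))
    finally have xN: "x (?pre N) = ?pre N #> a" .
    have "N <#> (M #> \<phi> a) = N #> \<phi> a"
      by (intro set_mult_rcos_subset subgroup_p_power_index_normal[where p = p] M N sub hom_in_carrier[OF \<phi> a(1)])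
    then show ?thesis
      using pro_p_map_rcos[where x = x, OF p \<phi> N a(1) xN] pro_p_map_rcos[where x = x, OF p \<phi> M a] by simp
  qed
  have "pro_p_map p G \<phi> x \<in> extensional ?P" by (simp add: pro_p_map_def)
  with coset compatible show ?thesis
    by (simp add: pro_p_completion_def PiE_iff)
qed

text \<open>Coordinate by coordinate, both sides are the coset of \<phi>\<open>(a b)\<close>, where
  \<open>a\<close> and \<open>b\<close> represent the two factors at the preimage of
  \<open>N\<close>; cosets of normal subgroups multiply through their representatives.\<close>

lemma pro_p_map_hom:
  assumes p: "prime p" and \<phi>: "\<phi> \<in> hom G G"
  shows "pro_p_map p G \<phi> \<in> hom (pro_p_completion p G) (pro_p_completion p G)"
proof (rule homI)
  let ?P = "p_power_index_normal p G"
  let ?pre = "\<lambda>N. \<phi> -` N \<inter> carrier G"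
  fix x y
  assume x: "x \<in> carrier (pro_p_completion p G)" and y: "y \<in> carrier (pro_p_completion p G)"
  show "pro_p_map p G \<phi> (x \<otimes>\<^bsub>pro_p_completion p G\<^esub> y) =
    pro_p_map p G \<phi> x \<otimes>\<^bsub>pro_p_completion p G\<^esub> pro_p_map p G \<phi> y"
  proof (rule extensionalityI)
    fix N assume N: "N \<in> ?P"
    have pre: "?pre N \<in> ?P" using p_power_index_normal_vimage[OF p \<phi> N] .
    obtain a where a: "a \<in> carrier G" "x (?pre N) = ?pre N #> a"
      using pro_p_completion_rcosE[OF x pre] .
    obtain b where b: "b \<in> carrier G" "y (?pre N) = ?pre N #> b"
      using pro_p_completion_rcosE[OF y pre] .
    have rcos: "(L #> c) <#> (L #> d) = L #> (c \<otimes> d)"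
      if "L \<in> ?P" "c \<in> carrier G" "d \<in> carrier G" for L c d
      by (rule normal.rcos_sum) (use that in \<open>auto simp: p_power_index_normal_def\<close>)
    have "(x \<otimes>\<^bsub>pro_p_completion p G\<^esub> y) (?pre N) = ?pre N #> (a \<otimes> b)"
      using a b pre rcos by (simp add: mult_pro_p_completion)
    then have "pro_p_map p G \<phi> (x \<otimes>\<^bsub>pro_p_completion p G\<^esub> y) N = N #> \<phi> (a \<otimes> b)"
      by (rule pro_p_map_rcos[where x = "x \<otimes>\<^bsub>pro_p_completion p G\<^esub> y", OF p \<phi> N m_closed[OF a(1) b(1)]])
    also have "\<dots> = pro_p_map p G \<phi> x N <#> pro_p_map p G \<phi> y N"
      using pro_p_map_rcos[where x = x, OF p \<phi> N a] pro_p_map_rcos[where x = y, OF p \<phi> N b] rcos[OF N]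
        hom_mult[OF \<phi> a(1) b(1)] hom_in_carrier[OF \<phi>] a b by simp
    finally show "pro_p_map p G \<phi> (x \<otimes>\<^bsub>pro_p_completion p G\<^esub> y) N =
        (pro_p_map p G \<phi> x \<otimes>\<^bsub>pro_p_completion p G\<^esub> pro_p_map p G \<phi> y) N"
      using N by (simp add: mult_pro_p_completion)
  qed (auto simp: pro_p_map_def mult_pro_p_completion)
qed (rule pro_p_map_carrier[OF p \<phi>])

text \<open>Coordinate \<open>N\<close> of the image depends only on the coordinate of
  \<open>x\<close> at the preimage of \<open>N\<close>. It is therefore a projection followed by a
  map of discrete spaces.\<close>

lemma continuous_map_pro_p_map:
  assumes p: "prime p" and \<phi>: "\<phi> \<in> hom G G"
  shows "continuous_map (pro_p_topology p G) (pro_p_topology p G) (pro_p_map p G \<phi>)"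
proof -
  let ?P = "p_power_index_normal p G"
  let ?T = "pro_p_topology p G"
  have "continuous_map ?T (discrete_topology (carrier (G Mod N))) (\<lambda>x. pro_p_map p G \<phi> x N)"
    if N: "N \<in> ?P" for N
  proof -
    let ?M = "\<phi> -` N \<inter> carrier G"
    have M: "?M \<in> ?P" using p_power_index_normal_vimage[OF p \<phi> N] .
    have "N <#> \<phi> ` C \<in> carrier (G Mod N)" if C: "C \<in> carrier (G Mod ?M)" for C
    proof -
      obtain a where "a \<in> carrier G" "C = ?M #> a"
        using C by (auto simp: FactGroup_def RCOSETS_def)
      \<comment> \<open>The constant family with value \<open>C\<close> stands in for
        \<open>x\<close>, since only its value at \<open>?M\<close> matters.\<close>
      then show ?thesis
        using pro_p_map_rcos[OF p \<phi> N, of a "\<lambda>_. C"] N rcos_in_carrier_Mod hom_in_carrier[OF \<phi>]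
        by (simp add: pro_p_map_def)
    qed
    then have "continuous_map (discrete_topology (carrier (G Mod ?M)))
        (discrete_topology (carrier (G Mod N))) (\<lambda>C. N <#> \<phi> ` C)"
      by (auto simp: continuous_map_def)
    from continuous_map_compose[OF continuous_map_pro_p_projection[OF M] this]
    show ?thesis using N by (simp add: comp_def pro_p_map_def)
  qed
  moreover have "pro_p_map p G \<phi> ` topspace ?T \<subseteq> carrier (pro_p_completion p G)"
    using pro_p_map_carrier[OF p \<phi>] by (auto simp: topspace_pro_p_topology)
  moreover have "pro_p_map p G \<phi> ` topspace ?T \<subseteq> extensional ?P"
    by (auto simp: pro_p_map_def)
  ultimately have "continuous_map ?T (subtopology
      (product_topology (\<lambda>N. discrete_topology (carrier (G Mod N))) ?P)
      (carrier (pro_p_completion p G))) (pro_p_map p G \<phi>)"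
    by (auto simp: continuous_map_in_subtopology continuous_map_componentwise)
  then show ?thesis by (simp only: pro_p_topology_def)
qed

text \<open>If two elements have the same image, their quotient lies in every normal subgroup of
  \<open>p\<close>-power index; residual finiteness makes it trivial.\<close>

lemma inj_on_pro_p_embedding:
  assumes "residually_finite_p p G"
  shows "inj_on (pro_p_embedding p G) (carrier G)"
proof (rule inj_onI)
  fix x y assume x: "x \<in> carrier G" and y: "y \<in> carrier G"
    and eq: "pro_p_embedding p G x = pro_p_embedding p G y"
  have "x \<otimes> inv y \<in> N" if N: "N \<in> p_power_index_normal p G" for N
  proof -
    have "N #> x = N #> y"
      using fun_cong[OF eq, of N] N by (simp add: pro_p_embedding_def)
    then have "x \<in> N #> y"
      using rcos_self[OF x subgroup_p_power_index_normal[OF N]] by simp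
    then show ?thesis
      using subgroup.subset[OF subgroup_p_power_index_normal[OF N]] y
      by (auto simp: r_coset_def m_assoc subset_iff)
  qed
  then have "x \<otimes> inv y = \<one>"
    using assms x y by (auto simp: residually_finite_p_def)
  then show "x = y" using x y by (metis inv_equality inv_inv inv_closed)
qed

end

section \<open>Retracts of \<open>G\<close> containing a test element of the completion\<close>

theorem proposition7p1:
  fixes G :: "('a, 'b) monoid_scheme" and p :: nat and g :: 'a
  assumes "prime p"
    and "group G"
    and "finitely_generated_group G"
    and "residually_finite_p p G"
    and "turner_group G"
    and "g \<in> carrier G"
    and "topological_test_element (pro_p_completion p G) (pro_p_topology p G)
           (pro_p_embedding p G g)"
  shows "test_element G g"
proof -
  interpret group G by fact
  have "H = carrier G" if H: "retract_of_group H G" and g: "g \<in> H" for H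
  proof -
    from H obtain r where sH: "subgroup H G" and r: "r \<in> epi G (G\<lparr>carrier := H\<rparr>)"
      and rH: "\<And>h. h \<in> H \<Longrightarrow> r h = h"
      by (auto simp: retract_of_group_def)
    have rc: "r x \<in> H" if "x \<in> carrier G" for x
      using r that by (auto simp: epi_def hom_def)
    \<comment> \<open>Widening the codomain from \<open>H\<close> to \<open>G\<close> turns the
      retraction into an endomorphism, which can be extended to the completion.\<close>
    have hom: "r \<in> hom G G"
      using r subgroup.subset[OF sH] by (auto simp: epi_def hom_def)
    let ?f = "pro_p_map p G r" and ?e = "pro_p_embedding p G"
    have fe: "?f (?e x) = ?e (r x)" if "x \<in> carrier G" for x
      using pro_p_map_embedding[OF \<open>prime p\<close> hom that] .
    have "?f \<in> iso (pro_p_completion p G) (pro_p_completion p G)"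
      using assms(7) pro_p_map_hom[OF \<open>prime p\<close> hom]
        continuous_map_pro_p_map[OF \<open>prime p\<close> hom] fe[OF \<open>g \<in> carrier G\<close>] rH[OF g]
      by (simp add: topological_test_element_def)
    then have inj: "inj_on ?f (carrier (pro_p_completion p G))"
      by (auto simp: iso_def bij_betw_def)
    have "x \<in> H" if x: "x \<in> carrier G" for x
    proof -
      have rx: "r x \<in> carrier G" using hom x by (rule hom_in_carrier)
      \<comment> \<open>Both sides equal \<open>?e (r x)\<close>, because \<open>r x\<close> lies in
        \<open>H\<close>, where \<open>r\<close> is the identity.\<close>
      have "?f (?e (r x)) = ?f (?e x)"
        using fe[OF x] fe[OF rx] rH[OF rc[OF x]] by simp
      then have "?e (r x) = ?e x"
        using inj_onD[OF inj] pro_p_embedding_carrier x rx by blast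
      then have "r x = x"
        using inj_onD[OF inj_on_pro_p_embedding[OF assms(4)]] x rx by blast
      then show ?thesis using rc[OF x] by simp
    qed
    then show ?thesis using subgroup.subset[OF sH] by blast
  qed
  \<comment> \<open>No proper retract contains \<open>g\<close>; in a Turner group this is exactly
    the criterion for being a test element.\<close>
  then show ?thesis
    using assms(5,6) by (auto simp: turner_group_def)
qed

end
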